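(* Let $A$ be a finite (nonempty) set of even order, let $n\in\mathbb N$ and let $o\in A$. Then $B_n(A)$ is not isomorphically realised by $\{TG(i,\alpha,o)\mid\alpha\in S_A,\ i<n\}$; that is, $B_n(A)\not\subseteq C(\{TG(i,\alpha,o)\mid\alpha\in S_A,\ i\in\mathbb N,\ i<n\})$.
   Context: $\mathbb N=\{1,2,3,\dots\}$. For a nonempty set $A$ and $n,m\in\mathbb N$, $M_{n,m}(A)$ is the set of all maps $f:A^n\to A^m$ (arity $n$, co-arity $m$), $M(A)=\bigcup_{n,m}M_{n,m}(A)$, and $f=(f_1,\dots,f_m)$ in components. $S_A$ is the set of permutations of $A$, and $B_n(A)$ is the set of bijections $A^n\to A^n$. Operations on $M(A)$, for $f\in M_{n,s}(A)$, $g\in M_{m,t}(A)$: - $i_1:A\to A$ is the identity (a constant, i.e. nullary operation); - $f\oplus g\in M_{n+m,s+t}(A)$, $(f\oplus g)(x_1,\dots,x_{n+m})=(f_1(x_1,\dots,x_n),\dots,f_s(x_1,\dots,x_n),g_1(x_{n+1},\dots,x_{n+m}),\dots,g_t(x_{n+1},\dots,x_{n+m}))$; - for $k\in\mathbb N$ with $k\le n$ and $k\le t$ (otherwise undefined), $f\circ_k g\in M_{n+m-k,s+t-k}(A)$ has $j$-th component, for $j\le s$, $f_j(g_1(x_1,\dots,x_m),\dots,g_k(x_1,\dots,x_m),x_{m+1},\dots,x_{m+n-k})$, and, for $s<j\le s+t-k$, $g_{k+j-s}(x_1,\dots,x_m)$; - $(\tau f)(x_1,\dots,x_n)=f(x_2,x_1,x_3,\dots,x_n)$,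 $(\zeta f)(x_1,\dots,x_n)=f(x_2,\dots,x_n,x_1)$, with $\tau f=\zeta f=f$ if $n=1$. A Toffoli algebra on $A$ is a subset of $M(A)$ containing $i_1$ and closed under $\oplus,\tau,\zeta$ and all partial operations $\circ_k$, $k\in\mathbb N$. For $F\subseteq M(A)$, $C(F)$ is the smallest Toffoli algebra containing $F$. A mapping $g$ is isomorphically realised by $F$ if $g\in C(F)$. Toffoli gates: for $\alpha\in S_A$, $o\in A$, $TG(1,\alpha,o)=\alpha$, and for $n\ge2$, $TG(n,\alpha,o)\in B_n(A)$ sends $(x_1,\dots,x_n)$ to $(x_1,\dots,x_{n-1},\alpha(x_n))$ if $x_1=\dots=x_{n-1}=o$, and fixes $(x_1,\dots,x_n)$ otherwise. *)

theory Defs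
  imports "HOL-Library.FuncSet" "HOL-Library.NList" "HOL-Combinatorics.Permutations"
begin

text \<open>
  A power of \<open>A\<close> is \<open>nlists n A\<close>, the lists of length \<open>n\<close> over \<open>A\<close>, with coordinate \<open>x\<^sub>j\<close> of
  a tuple being \<open>x ! (j - 1)\<close>. A map from the \<open>n\<close>-th to the \<open>m\<close>-th power carries its arity and
  co-arity, and its underlying function is extensional, so that two maps are equal iff they have
  the same arity, the same co-arity and the same values on the \<open>n\<close>-th power of \<open>A\<close>.
\<close>

datatype 'a vmap = VMap (arity: nat) (coarity: nat) (fn: "'a list \<Rightarrow> 'a list")

definition vmaps :: "'a set \<Rightarrow> nat \<Rightarrow> nat \<Rightarrow> 'a vmap set" where
  "vmaps A n m = {f. arity f = n \<and> coarity f = m \<and> fn f \<in> nlists n A \<rightarrow>\<^sub>E nlists m A}"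

definition all_maps :: "'a set \<Rightarrow> 'a vmap set" where
  "all_maps A = (\<Union>n\<in>{1..}. \<Union>m\<in>{1..}. vmaps A n m)"

definition bijections :: "'a set \<Rightarrow> nat \<Rightarrow> 'a vmap set" where
  "bijections A n = {f \<in> vmaps A n n. bij_betw (fn f) (nlists n A) (nlists n A)}"

definition id_map :: "'a set \<Rightarrow> 'a vmap" where
  "id_map A = VMap 1 1 (\<lambda>x\<in>nlists 1 A. x)"

definition oplus :: "'a set \<Rightarrow> 'a vmap \<Rightarrow> 'a vmap \<Rightarrow> 'a vmap" where
  "oplus A f g = VMap (arity f + arity g) (coarity f + coarity g)
     (\<lambda>x\<in>nlists (arity f + arity g) A. fn f (take (arity f) x) @ fn g (drop (arity f) x))"

text \<open>
  The partial operation \<open>f \<circ>\<^sub>k g\<close>: the first \<open>k\<close> outputs of \<open>g\<close> are fed into the first \<open>k\<close> inputs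
  of \<open>f\<close>, and the remaining outputs of \<open>g\<close> are appended to those of \<open>f\<close>. It is meaningful only
  for \<open>1 \<le> k\<close>, \<open>k \<le> arity f\<close> and \<open>k \<le> coarity g\<close>; this domain is imposed wherever it is used.
\<close>

definition kcomp :: "'a set \<Rightarrow> nat \<Rightarrow> 'a vmap \<Rightarrow> 'a vmap \<Rightarrow> 'a vmap" where
  "kcomp A k f g = VMap (arity f + arity g - k) (coarity f + coarity g - k)
     (\<lambda>x\<in>nlists (arity f + arity g - k) A.
        let y = fn g (take (arity g) x)
        in fn f (take k y @ drop (arity g) x) @ drop k y)"

fun swap2 :: "'a list \<Rightarrow> 'a list" where
  "swap2 (a # b # xs) = b # a # xs"
| "swap2 xs = xs"

text \<open>Both \<open>swap2\<close> and \<open>rotate1\<close> are the identity on lists of length 1, as required for arity 1.\<close>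

definition tau :: "'a set \<Rightarrow> 'a vmap \<Rightarrow> 'a vmap" where
  "tau A f = VMap (arity f) (coarity f) (\<lambda>x\<in>nlists (arity f) A. fn f (swap2 x))"

definition zeta :: "'a set \<Rightarrow> 'a vmap \<Rightarrow> 'a vmap" where
  "zeta A f = VMap (arity f) (coarity f) (\<lambda>x\<in>nlists (arity f) A. fn f (rotate1 x))"

definition toffoli_algebra :: "'a set \<Rightarrow> 'a vmap set \<Rightarrow> bool" where
  "toffoli_algebra A T \<longleftrightarrow>
     T \<subseteq> all_maps A \<and>
     id_map A \<in> T \<and>
     (\<forall>f\<in>T. \<forall>g\<in>T. oplus A f g \<in> T) \<and>
     (\<forall>f\<in>T. tau A f \<in> T) \<and>
     (\<forall>f\<in>T. zeta A f \<in> T) \<and>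
     (\<forall>f\<in>T. \<forall>g\<in>T. \<forall>k. 1 \<le> k \<and> k \<le> arity f \<and> k \<le> coarity g \<longrightarrow> kcomp A k f g \<in> T)"

definition toffoli_closure :: "'a set \<Rightarrow> 'a vmap set \<Rightarrow> 'a vmap set" where
  "toffoli_closure A F = \<Inter>{T. toffoli_algebra A T \<and> F \<subseteq> T}"

text \<open>
  For \<open>n = 1\<close> the condition is vacuous (\<open>butlast x = []\<close>), so the gate is \<open>\<alpha>\<close> itself.
\<close>

definition toffoli_gate :: "'a set \<Rightarrow> nat \<Rightarrow> ('a \<Rightarrow> 'a) \<Rightarrow> 'a \<Rightarrow> 'a vmap" where
  "toffoli_gate A n \<alpha> c = VMap n n
     (\<lambda>x\<in>nlists n A. if \<forall>y\<in>set (butlast x). y = c then butlast x @ [\<alpha> (last x)] else x)"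

text \<open>The closure of \<open>F \<subseteq> all_maps A\<close> is indeed the smallest Toffoli algebra containing \<open>F\<close>.\<close>

lemma vmap_in_all_maps_iff:
  "f \<in> all_maps A \<longleftrightarrow>
     1 \<le> arity f \<and> 1 \<le> coarity f \<and> fn f \<in> nlists (arity f) A \<rightarrow>\<^sub>E nlists (coarity f) A"
  by (auto simp: all_maps_def vmaps_def)

lemma fn_in_nlists:
  assumes "f \<in> all_maps A" "length x = arity f" "set x \<subseteq> A"
  shows "length (fn f x) = coarity f" "set (fn f x) \<subseteq> A"
proof -
  have "fn f x \<in> nlists (coarity f) A"
    using assms by (auto simp: vmap_in_all_maps_iff intro: PiE_mem nlistsI)
  then show "length (fn f x) = coarity f" "set (fn f x) \<subseteq> A" by simp_all
qed

lemma length_swap2 [simp]: "length (swap2 x) = length x"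
  by (cases x rule: swap2.cases) auto

lemma set_swap2 [simp]: "set (swap2 x) = set x"
  by (cases x rule: swap2.cases) auto

lemma oplus_in_all_maps:
  assumes "f \<in> all_maps A" "g \<in> all_maps A"
  shows "oplus A f g \<in> all_maps A"
proof -
  have "fn f (take (arity f) x) @ fn g (drop (arity f) x) \<in> nlists (coarity f + coarity g) A"
    if x: "x \<in> nlists (arity f + arity g) A" for x
  proof -
    have l: "length x = arity f + arity g" and s: "set x \<subseteq> A" using x by simp_all
    have "set (take (arity f) x) \<subseteq> A" "set (drop (arity f) x) \<subseteq> A"
      using s set_take_subset set_drop_subset by fast+
    then show ?thesis
      using fn_in_nlists[OF assms(1), of "take (arity f) x"]
        fn_in_nlists[OF assms(2), of "drop (arity f) x"] l
      by (intro nlistsI) auto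
  qed
  moreover have "1 \<le> arity f" "1 \<le> coarity f"
    using assms(1) by (auto simp: vmap_in_all_maps_iff)
  ultimately show ?thesis
    by (auto simp: oplus_def vmap_in_all_maps_iff restrict_PiE_iff)
qed

lemma kcomp_in_all_maps:
  assumes "f \<in> all_maps A" "g \<in> all_maps A" "k \<le> arity f" "k \<le> coarity g"
  shows "kcomp A k f g \<in> all_maps A"
proof -
  have pos: "1 \<le> arity g" "1 \<le> coarity f"
    using assms(1,2) by (auto simp: vmap_in_all_maps_iff)
  have "(let y = fn g (take (arity g) x) in fn f (take k y @ drop (arity g) x) @ drop k y)
      \<in> nlists (coarity f + coarity g - k) A"
    if x: "x \<in> nlists (arity f + arity g - k) A" for x
  proof -
    have l: "length x = arity f + arity g - k" and s: "set x \<subseteq> A" using x by simp_all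
    define y where "y = fn g (take (arity g) x)"
    have sub: "set (take (arity g) x) \<subseteq> A" "set (drop (arity g) x) \<subseteq> A"
      using s set_take_subset set_drop_subset by fast+
    have y: "length y = coarity g" "set y \<subseteq> A"
      using fn_in_nlists[OF assms(2), of "take (arity g) x"] sub l assms(3)
      by (auto simp: y_def)
    have suby: "set (take k y) \<subseteq> A" "set (drop k y) \<subseteq> A"
      using y set_take_subset set_drop_subset by fast+
    show ?thesis
      using fn_in_nlists[OF assms(1), of "take k y @ drop (arity g) x"] sub suby y l assms(3,4)
      by (intro nlistsI) (auto simp: Let_def y_def[symmetric])
  qed
  then show ?thesis
    using pos assms(3,4) by (auto simp: kcomp_def vmap_in_all_maps_iff restrict_PiE_iff)
qed

lemma toffoli_algebra_all_maps: "toffoli_algebra A (all_maps A)"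
proof -
  have "tau A f \<in> all_maps A" "zeta A f \<in> all_maps A" if f: "f \<in> all_maps A" for f
  proof -
    have "fn f (swap2 x) \<in> nlists (coarity f) A" "fn f (rotate1 x) \<in> nlists (coarity f) A"
      if x: "x \<in> nlists (arity f) A" for x
    proof -
      have "length x = arity f" "set x \<subseteq> A" using x by (auto simp only: nlists_def)
      then show "fn f (swap2 x) \<in> nlists (coarity f) A" "fn f (rotate1 x) \<in> nlists (coarity f) A"
        by (intro nlistsI fn_in_nlists[OF f]; simp)+
    qed
    moreover have "1 \<le> arity f" "1 \<le> coarity f"
      using f by (auto simp: vmap_in_all_maps_iff)
    ultimately show "tau A f \<in> all_maps A" "zeta A f \<in> all_maps A"
      by (simp_all add: tau_def zeta_def vmap_in_all_maps_iff restrict_PiE_iff)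
  qed
  moreover have "id_map A \<in> all_maps A"
    by (auto simp: id_map_def vmap_in_all_maps_iff restrict_PiE_iff)
  ultimately show ?thesis
    by (auto simp: toffoli_algebra_def intro: oplus_in_all_maps kcomp_in_all_maps)
qed

lemma toffoli_algebra_closure:
  assumes "F \<subseteq> all_maps A"
  shows "toffoli_algebra A (toffoli_closure A F)"
proof -
  have "toffoli_closure A F \<subseteq> all_maps A"
    using assms toffoli_algebra_all_maps by (auto simp: toffoli_closure_def)
  then show ?thesis
    unfolding toffoli_algebra_def
    by (simp add: toffoli_closure_def toffoli_algebra_def)
qed

lemma toffoli_closure_superset: "F \<subseteq> toffoli_closure A F"
  by (auto simp: toffoli_closure_def)

lemma toffoli_closure_least:
  "toffoli_algebra A T \<Longrightarrow> F \<subseteq> T \<Longrightarrow> toffoli_closure A F \<subseteq> T"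
  by (auto simp: toffoli_closure_def)

lemma toffoli_gate_in_bijections:
  assumes "\<alpha> permutes A" "1 \<le> n"
  shows "toffoli_gate A n \<alpha> c \<in> bijections A n"
proof -
  define G where "G \<beta> x = (if \<forall>y\<in>set (butlast x). y = c then butlast x @ [\<beta> (last x)] else x)"
    for \<beta> x
  have mem: "G \<beta> x \<in> nlists n A" if "\<beta> permutes A" "x \<in> nlists n A" for \<beta> x
  proof -
    have x: "length x = n" "set x \<subseteq> A" using that(2) by (auto simp only: nlists_def)
    then have "x \<noteq> []" using assms(2) by auto
    then have "last x \<in> A" "set (butlast x) \<subseteq> A"
      using x(2) last_in_set[of x] in_set_butlastD[of _ x] by blast+
    moreover have "\<beta> (last x) \<in> A"
      using calculation(1) permutes_in_image[OF that(1)] by blast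
    ultimately show ?thesis
      using x assms(2) by (intro nlistsI) (simp_all add: G_def)
  qed
  have undo: "G \<gamma> (G \<beta> x) = x" if "x \<in> nlists n A" "\<And>a. \<gamma> (\<beta> a) = a" for \<beta> \<gamma> x
  proof -
    have "length x = n" using that(1) by (simp only: nlists_def mem_Collect_eq)
    then have "x \<noteq> []" using assms(2) by auto
    then show ?thesis by (simp add: G_def that(2))
  qed
  have "bij_betw (G \<alpha>) (nlists n A) (nlists n A)"
  proof (rule bij_betw_byWitness[where f' = "G (inv \<alpha>)"])
    show "\<forall>x\<in>nlists n A. G (inv \<alpha>) (G \<alpha> x) = x" "\<forall>x\<in>nlists n A. G \<alpha> (G (inv \<alpha>) x) = x"
      using undo permutes_inverses[OF assms(1)] by blast+
    show "G \<alpha> ` nlists n A \<subseteq> nlists n A" "G (inv \<alpha>) ` nlists n A \<subseteq> nlists n A"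
      using mem assms(1) permutes_inv[OF assms(1)] by blast+
  qed
  moreover have "toffoli_gate A n \<alpha> c = VMap n n (restrict (G \<alpha>) (nlists n A))"
    by (simp add: toffoli_gate_def G_def[abs_def])
  ultimately show ?thesis
    using mem[OF assms(1)]
    by (simp add: bijections_def vmaps_def restrict_PiE_iff bij_betw_restrict_eq)
qed

end

theory Submission
  imports Defs
begin

text \<open>
  Arities only grow under the operations of a Toffoli algebra: the maps combined in \<open>oplus\<close> or
  \<open>kcomp\<close> have arity at most that of the result. Hence every \<open>n\<close>-ary map generated by gates of
  arity less than \<open>n\<close> is a composition of bijections of \<open>A\<^sup>n\<close> of three kinds: those that act on
  a proper initial segment of the coordinates, those that act on a proper final segment, and the
  exchange of the first two coordinates. Any property \<open>P\<close> of bijections of \<open>A\<^sup>n\<close> that these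
  have, and that composition preserves, holds for all generated \<open>n\<close>-ary maps
  (\<open>gate_invariant.closure_invariant\<close>).

  Let \<open>card A\<close> be even and \<open>n \<noteq> 2\<close>. Then being an even permutation of \<open>A\<^sup>n\<close> is such a property.
  A permutation \<open>p\<close> of some of the coordinates acts on \<open>A\<^sup>n\<close> as one copy of \<open>p\<close> for each value of
  the remaining ones, so as an even number of copies, and the signs cancel
  (\<open>sign_on_parallel\<close>). This covers the exchange of two coordinates once there is a third one,
  and for \<open>n = 1\<close> that exchange is the identity.

  For \<open>n = 2\<close> the exchange of coordinates is an odd permutation whenever \<open>card A\<close> is not divisible
  by 4, and generated maps need not be even. Instead, unary gates and the exchange only
  produce maps in which each output depends on a single input, a different one for each output
  (\<open>gate_invariant_separable\<close>).

  Both properties fail for the \<open>n\<close>-ary Toffoli gate of the transposition of \<open>c\<close> with another element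
  \<open>a\<close>: it is a single transposition on \<open>A\<^sup>n\<close>, hence odd, and for \<open>n = 2\<close> its second output depends
  on both inputs.
\<close>

section \<open>Acting on some of the coordinates\<close>

text \<open>
  As conditional rewrite rules these two loop as soon as their premise is unfolded.
\<close>
declare nlistsE_length [simp del] nlistsE_set [simp del]

definition on_prefix :: "nat \<Rightarrow> ('a list \<Rightarrow> 'a list) \<Rightarrow> 'a list \<Rightarrow> 'a list" where
  "on_prefix k p x = p (take k x) @ drop k x"

definition on_suffix :: "nat \<Rightarrow> ('a list \<Rightarrow> 'a list) \<Rightarrow> 'a list \<Rightarrow> 'a list" where
  "on_suffix k p x = take k x @ p (drop k x)"

lemma nlists_eq: "nlists n A = {xs. set xs \<subseteq> A \<and> length xs = n}"
  by (auto simp: nlists_def)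

lemma finite_nlists: "finite A \<Longrightarrow> finite (nlists n A)"
  unfolding nlists_eq by (rule finite_lists_length_eq)

lemma card_nlists: "finite A \<Longrightarrow> card (nlists n A) = card A ^ n"
  unfolding nlists_eq by (rule card_lists_length_eq)

lemma take_in_nlists: "x \<in> nlists n A \<Longrightarrow> k \<le> n \<Longrightarrow> take k x \<in> nlists k A"
  using set_take_subset[of k x] by (auto simp: nlists_def)

lemma drop_in_nlists: "x \<in> nlists n A \<Longrightarrow> drop k x \<in> nlists (n - k) A"
  using set_drop_subset[of k x] by (auto simp: nlists_def)

lemma on_prefix_in_nlists:
  assumes "p \<in> nlists k A \<rightarrow> nlists k A" "k \<le> n" "x \<in> nlists n A"
  shows "on_prefix k p x \<in> nlists n A"
proof -
  have "p (take k x) \<in> nlists k A"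
    using funcset_mem[OF assms(1)] take_in_nlists[OF assms(3,2)] by simp
  moreover have "drop k x \<in> nlists (n - k) A"
    using assms(3) by (rule drop_in_nlists)
  ultimately show ?thesis
    using nlists_appendI[of "p (take k x)" k A "drop k x" "n - k"] assms(2)
    by (simp add: on_prefix_def)
qed

lemma on_suffix_in_nlists:
  assumes "p \<in> nlists (n - k) A \<rightarrow> nlists (n - k) A" "k \<le> n" "x \<in> nlists n A"
  shows "on_suffix k p x \<in> nlists n A"
proof -
  have "p (drop k x) \<in> nlists (n - k) A"
    using funcset_mem[OF assms(1)] drop_in_nlists[OF assms(3)] by simp
  moreover have "take k x \<in> nlists k A"
    using assms(3,2) by (rule take_in_nlists)
  ultimately show ?thesis
    using nlists_appendI[of "take k x" k A "p (drop k x)" "n - k"] assms(2)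
    by (simp add: on_suffix_def)
qed

lemma bij_betw_on_prefix:
  assumes p: "bij_betw p (nlists k A) (nlists k A)" and "k \<le> n"
  shows "bij_betw (on_prefix k p) (nlists n A) (nlists n A)"
proof -
  define q where "q = inv_into (nlists k A) p"
  have q: "bij_betw q (nlists k A) (nlists k A)"
    using bij_betw_inv_into[OF p] by (simp add: q_def)
  have maps: "p \<in> nlists k A \<rightarrow> nlists k A" "q \<in> nlists k A \<rightarrow> nlists k A"
    using p q by (simp_all add: bij_betw_imp_funcset)
  have inverse: "\<forall>x\<in>nlists k A. q (p x) = x" "\<forall>x\<in>nlists k A. p (q x) = x"
    using bij_betw_inv_into_left[OF p] bij_betw_inv_into_right[OF p] by (auto simp: q_def)
  have undo: "on_prefix k s (on_prefix k r x) = x"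
    if "r \<in> nlists k A \<rightarrow> nlists k A" "\<forall>x\<in>nlists k A. s (r x) = x" "x \<in> nlists n A" for r s x
  proof -
    have "take k x \<in> nlists k A" using that(3) assms(2) by (rule take_in_nlists)
    then have "r (take k x) \<in> nlists k A" "s (r (take k x)) = take k x"
      using funcset_mem[OF that(1)] that(2) by simp_all
    then have "length (r (take k x)) = k" "s (r (take k x)) = take k x"
      by (simp_all add: nlistsE_length)
    then show ?thesis by (simp add: on_prefix_def)
  qed
  show ?thesis
  proof (rule bij_betw_byWitness[where f' = "on_prefix k q"])
    show "\<forall>x\<in>nlists n A. on_prefix k q (on_prefix k p x) = x"
      using undo[OF maps(1) inverse(1)] by blast
    show "\<forall>x\<in>nlists n A. on_prefix k p (on_prefix k q x) = x"
      using undo[OF maps(2) inverse(2)] by blast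
    show "on_prefix k p ` nlists n A \<subseteq> nlists n A"
      using on_prefix_in_nlists[OF maps(1) assms(2)] by (rule image_subsetI)
    show "on_prefix k q ` nlists n A \<subseteq> nlists n A"
      using on_prefix_in_nlists[OF maps(2) assms(2)] by (rule image_subsetI)
  qed
qed

lemma bij_betw_on_suffix:
  assumes p: "bij_betw p (nlists (n - k) A) (nlists (n - k) A)" and "k \<le> n"
  shows "bij_betw (on_suffix k p) (nlists n A) (nlists n A)"
proof -
  define q where "q = inv_into (nlists (n - k) A) p"
  have q: "bij_betw q (nlists (n - k) A) (nlists (n - k) A)"
    using bij_betw_inv_into[OF p] by (simp add: q_def)
  have maps: "p \<in> nlists (n - k) A \<rightarrow> nlists (n - k) A" "q \<in> nlists (n - k) A \<rightarrow> nlists (n - k) A"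
    using p q by (simp_all add: bij_betw_imp_funcset)
  have inverse: "\<forall>x\<in>nlists (n - k) A. q (p x) = x" "\<forall>x\<in>nlists (n - k) A. p (q x) = x"
    using bij_betw_inv_into_left[OF p] bij_betw_inv_into_right[OF p] by (auto simp: q_def)
  have undo: "on_suffix k s (on_suffix k r x) = x"
    if "\<forall>x\<in>nlists (n - k) A. s (r x) = x" "x \<in> nlists n A" for r s x
  proof -
    have "drop k x \<in> nlists (n - k) A" using that(2) by (rule drop_in_nlists)
    then have "s (r (drop k x)) = drop k x" using that(1) by blast
    moreover have "length (take k x) = k" using nlistsE_length[OF that(2)] assms(2) by simp
    ultimately show ?thesis by (simp add: on_suffix_def)
  qed
  show ?thesis
  proof (rule bij_betw_byWitness[where f' = "on_suffix k q"])
    show "\<forall>x\<in>nlists n A. on_suffix k q (on_suffix k p x) = x"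
      using undo[where r = p and s = q] inverse(1) by blast
    show "\<forall>x\<in>nlists n A. on_suffix k p (on_suffix k q x) = x"
      using undo[where r = q and s = p] inverse(2) by blast
    show "on_suffix k p ` nlists n A \<subseteq> nlists n A"
      using on_suffix_in_nlists[OF maps(1) assms(2)] by (rule image_subsetI)
    show "on_suffix k q ` nlists n A \<subseteq> nlists n A"
      using on_suffix_in_nlists[OF maps(2) assms(2)] by (rule image_subsetI)
  qed
qed

lemma swap2_swap2 [simp]: "swap2 (swap2 x) = x"
  by (cases x rule: swap2.cases) auto

lemma bij_betw_swap2: "bij_betw swap2 (nlists n A) (nlists n A)"
  by (rule bij_betw_byWitness[where f' = swap2]) (auto simp: nlists_def)

lemma bij_betw_rotate: "bij_betw (rotate r) (nlists n A) (nlists n A)"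
proof (rule bij_betw_byWitness[where f' = "\<lambda>x. rotate (n - r mod n) x"])
  have *: "rotate (n - r mod n) (rotate r x) = x" if "length x = n" for x :: "'a list"
  proof (cases "n = 0")
    case False
    have "rotate (n - r mod n) (rotate r x) = rotate (n - r mod n) (rotate (r mod n) x)"
      using rotate_conv_mod[of r x] that by simp
    also have "\<dots> = rotate n x" using False by (simp add: rotate_rotate)
    also have "\<dots> = x" using that by (simp add: rotate_id)
    finally show ?thesis .
  qed (use that in simp)
  then show "\<forall>x\<in>nlists n A. rotate (n - r mod n) (rotate r x) = x" by (simp add: nlists_def)
  show "\<forall>x\<in>nlists n A. rotate r (rotate (n - r mod n) x) = x"
    using * by (simp add: nlists_def rotate_rotate add.commute)
qed (auto simp: nlists_def)

section \<open>Invariants of the arity-n part of a Toffoli algebra\<close>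

text \<open>
  The axioms are what the operations of a Toffoli algebra require of a property of bijections
  of \<open>A\<^sup>n\<close>. The rule \<open>cong\<close> makes \<open>P\<close> depend only on the values on \<open>A\<^sup>n\<close>, so that \<open>P\<close> can be
  applied both to extensional functions and to plain list functions such as \<open>rotate1\<close>.
\<close>
locale gate_invariant =
  fixes A :: "'a set" and n :: nat and P :: "('a list \<Rightarrow> 'a list) \<Rightarrow> bool"
  assumes cong: "P p \<Longrightarrow> (\<And>x. x \<in> nlists n A \<Longrightarrow> p x = q x) \<Longrightarrow> P q"
    and comp: "bij_betw p (nlists n A) (nlists n A) \<Longrightarrow> bij_betw q (nlists n A) (nlists n A) \<Longrightarrow>
      P p \<Longrightarrow> P q \<Longrightarrow> P (p \<circ> q)"
    and prefix: "1 \<le> k \<Longrightarrow> k < n \<Longrightarrow> bij_betw p (nlists k A) (nlists k A) \<Longrightarrow> P (on_prefix k p)"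
    and suffix: "1 \<le> k \<Longrightarrow> k < n \<Longrightarrow> bij_betw p (nlists (n - k) A) (nlists (n - k) A) \<Longrightarrow>
      P (on_suffix k p)"
    and swap2: "P swap2"
begin

text \<open>
  A cyclic shift exchanges the first two coordinates and then shifts all but the first, so
  it needs no axiom of its own.
\<close>
lemma rotate1: "P rotate1"
proof (cases "n < 2")
  case True
  show ?thesis
  proof (rule cong[OF swap2])
    fix x assume "x \<in> nlists n A"
    then have "length x = n" by (rule nlistsE_length)
    then show "swap2 x = rotate1 x" using True by (cases x rule: swap2.cases) auto
  qed
next
  case False
  have rot: "bij_betw rotate1 (nlists (n - 1) A) (nlists (n - 1) A)"
    using bij_betw_rotate[of 1 "n - 1" A] by (simp add: rotate_def)
  have "P (on_suffix 1 rotate1 \<circ> swap2)"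
    using False by (intro comp swap2 suffix rot bij_betw_on_suffix bij_betw_swap2) auto
  then show ?thesis
  proof (rule cong)
    fix x assume "x \<in> nlists n A"
    then have "length x = n" by (rule nlistsE_length)
    then show "(on_suffix 1 rotate1 \<circ> swap2) x = rotate1 x"
      using False by (cases x rule: swap2.cases) (auto simp: on_suffix_def)
  qed
qed

text \<open>
  Only the \<open>n\<close>-ary members have to satisfy \<open>P\<close>. Maps of smaller arity are arbitrary bijections: they
  enter \<open>n\<close>-ary maps only through \<open>prefix\<close> and \<open>suffix\<close>. Maps of larger arity never contribute
  to \<open>n\<close>-ary ones.
\<close>
definition admissible :: "'a vmap set" where
  "admissible = {f. 1 \<le> arity f \<and> f \<in> bijections A (arity f) \<and> (arity f = n \<longrightarrow> P (fn f))}"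

lemma admissibleD:
  assumes "f \<in> admissible"
  shows "1 \<le> arity f" "coarity f = arity f"
    "bij_betw (fn f) (nlists (arity f) A) (nlists (arity f) A)" "arity f = n \<Longrightarrow> P (fn f)"
  using assms by (auto simp: admissible_def bijections_def vmaps_def)

lemma admissibleI:
  assumes "1 \<le> m" and q: "bij_betw q (nlists m A) (nlists m A)"
    and "\<And>x. x \<in> nlists m A \<Longrightarrow> g x = q x" and "m = n \<Longrightarrow> P q"
  shows "VMap m m (restrict g (nlists m A)) \<in> admissible"
proof -
  have "bij_betw (restrict g (nlists m A)) (nlists m A) (nlists m A)"
    using q assms(3) by (subst bij_betw_cong[where g = q]) auto
  moreover have "restrict g (nlists m A) \<in> nlists m A \<rightarrow>\<^sub>E nlists m A"
    using bij_betwE[OF calculation] by auto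
  moreover have "P (restrict g (nlists m A))" if "m = n"
    by (rule cong[OF assms(4)[OF that]]) (simp add: assms(3) that)
  ultimately show ?thesis
    using assms(1) by (simp add: admissible_def bijections_def vmaps_def)
qed

lemma prefix_of_admissible:
  assumes "f \<in> admissible" and "arity f \<le> n"
  shows "P (on_prefix (arity f) (fn f))"
proof (cases "arity f = n")
  case True
  show ?thesis
    by (rule cong[OF admissibleD(4)[OF assms(1) True]])
      (simp add: on_prefix_def True nlistsE_length)
next
  case False
  then show ?thesis using assms prefix admissibleD(1,3) by simp
qed

lemma oplus_admissible:
  assumes f: "f \<in> admissible" and g: "g \<in> admissible"
  shows "oplus A f g \<in> admissible"
proof -
  let ?i = "arity f" and ?j = "arity g"
  let ?p = "on_prefix ?i (fn f)" and ?q = "on_suffix ?i (fn g)"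
  have p: "bij_betw ?p (nlists (?i + ?j) A) (nlists (?i + ?j) A)"
    using admissibleD(3)[OF f] by (rule bij_betw_on_prefix) simp
  have q: "bij_betw ?q (nlists (?i + ?j) A) (nlists (?i + ?j) A)"
    using admissibleD(3)[OF g] by (intro bij_betw_on_suffix) simp_all
  show ?thesis
    unfolding oplus_def admissibleD(2)[OF f] admissibleD(2)[OF g]
  proof (rule admissibleI[where q = "?p \<circ> ?q"])
    show "1 \<le> ?i + ?j" using admissibleD(1)[OF f] by simp
    show "bij_betw (?p \<circ> ?q) (nlists (?i + ?j) A) (nlists (?i + ?j) A)"
      by (rule bij_betw_trans[OF q p])
    show "fn f (take ?i x) @ fn g (drop ?i x) = (?p \<circ> ?q) x" if "x \<in> nlists (?i + ?j) A" for x
      using nlistsE_length[OF that] by (simp add: on_prefix_def on_suffix_def)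
    assume n: "?i + ?j = n"
    have "P ?q"
      using admissibleD(1)[OF f] admissibleD(1)[OF g] admissibleD(3)[OF g] n by (intro suffix) auto
    moreover have "P ?p" using prefix_of_admissible[OF f] n by simp
    ultimately show "P (?p \<circ> ?q)" using comp p q n by simp
  qed
qed

text \<open>
  The map \<open>kcomp A k f g\<close> factors into three steps: \<open>g\<close> on an initial segment, then a rotation that
  carries the \<open>arity g - k\<close> outputs of \<open>g\<close> not fed into \<open>f\<close> past the untouched inputs to
  the end, then \<open>f\<close> on an initial segment. Since \<open>k \<ge> 1\<close>, the rotation leaves the first coordinate
  fixed, so that it is covered by \<open>suffix\<close>.
\<close>
lemma kcomp_admissible:
  assumes f: "f \<in> admissible" and g: "g \<in> admissible"
    and k: "1 \<le> k" "k \<le> arity f" "k \<le> coarity g"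
  shows "kcomp A k f g \<in> admissible"
proof -
  let ?i = "arity f" and ?j = "arity g"
  let ?m = "?i + ?j - k"
  let ?p = "on_prefix ?i (fn f)" and ?q = "on_prefix ?j (fn g)"
  let ?r = "on_suffix k (rotate (?j - k))"
  have kj: "k \<le> ?j" using k(3) admissibleD(2)[OF g] by simp
  have p: "bij_betw ?p (nlists ?m A) (nlists ?m A)"
    using admissibleD(3)[OF f] by (rule bij_betw_on_prefix) (use kj in simp)
  have q: "bij_betw ?q (nlists ?m A) (nlists ?m A)"
    using admissibleD(3)[OF g] by (rule bij_betw_on_prefix) (use k(2) in simp)
  have r: "bij_betw ?r (nlists ?m A) (nlists ?m A)"
    by (rule bij_betw_on_suffix[OF bij_betw_rotate]) (use k(2) kj in simp)
  have rq: "bij_betw (?r \<circ> ?q) (nlists ?m A) (nlists ?m A)"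
    by (rule bij_betw_trans[OF q r])
  show ?thesis
    unfolding kcomp_def admissibleD(2)[OF f] admissibleD(2)[OF g]
  proof (rule admissibleI[where q = "?p \<circ> (?r \<circ> ?q)"])
    show "1 \<le> ?m" using k kj by simp
    show "bij_betw (?p \<circ> (?r \<circ> ?q)) (nlists ?m A) (nlists ?m A)"
      by (rule bij_betw_trans[OF rq p])
    show "(let y = fn g (take ?j x) in fn f (take k y @ drop ?j x) @ drop k y)
        = (?p \<circ> (?r \<circ> ?q)) x" if x: "x \<in> nlists ?m A" for x
    proof -
      define y where "y = fn g (take ?j x)"
      have "take ?j x \<in> nlists ?j A" using x by (rule take_in_nlists) (use k(2) in simp)
      then have "y \<in> nlists ?j A"
        using bij_betwE[OF admissibleD(3)[OF g]] y_def by blast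
      then have y: "length y = ?j" by (rule nlistsE_length)
      have "rotate (?j - k) (drop k y @ drop ?j x) = drop ?j x @ drop k y"
        using rotate_append[of "drop k y" "drop ?j x"] y by simp
      moreover have "length (drop ?j x) = ?i - k" using nlistsE_length[OF x] by simp
      ultimately have "(?p \<circ> (?r \<circ> ?q)) x = fn f (take k y @ drop ?j x) @ drop k y"
        using y kj k(2) by (simp add: on_prefix_def on_suffix_def flip: y_def)
      then show ?thesis by (simp add: y_def Let_def)
    qed
    assume n: "?m = n"
    have P: "P ?p" "P ?q" using prefix_of_admissible[OF f] prefix_of_admissible[OF g] n k kj by auto
    show "P (?p \<circ> (?r \<circ> ?q))"
    proof (cases "k = n")
      \<comment> \<open>Then \<open>f\<close> and \<open>g\<close> are both \<open>n\<close>-ary and there is nothing to rotate.\<close>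
      case True
      have "P (?p \<circ> ?q)" using comp p q P n by simp
      then show ?thesis
      proof (rule cong)
        fix x assume x: "x \<in> nlists n A"
        then have "?q x \<in> nlists n A" using bij_betwE[OF q] n by simp
        then have "?r (?q x) = ?q x"
          using True by (simp add: on_suffix_def nlistsE_length)
        then show "(?p \<circ> ?q) x = (?p \<circ> (?r \<circ> ?q)) x" by simp
      qed
    next
      case False
      then have "P ?r" using suffix[OF k(1) _ bij_betw_rotate] n k(2) kj by simp
      then show ?thesis using comp p q r rq P n by simp
    qed
  qed
qed

lemma toffoli_algebra_admissible: "toffoli_algebra A admissible"
proof -
  have "admissible \<subseteq> all_maps A"
  proof
    fix f assume "f \<in> admissible"
    then show "f \<in> all_maps A"
      by (simp add: admissible_def bijections_def vmaps_def vmap_in_all_maps_iff)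
  qed
  \<comment> \<open>On a single coordinate \<open>swap2\<close> is the identity, so the axiom \<open>swap2\<close> yields \<open>P\<close> for it.\<close>
  moreover have "id_map A \<in> admissible"
    unfolding id_map_def
  proof (rule admissibleI[where q = swap2])
    show "x = swap2 x" if "x \<in> nlists 1 A" for x
      using nlistsE_length[OF that] by (cases x rule: swap2.cases) auto
  qed (simp_all add: bij_betw_swap2 swap2)
  moreover have "tau A f \<in> admissible" "zeta A f \<in> admissible" if f: "f \<in> admissible" for f
  proof -
    have precompose: "VMap (arity f) (arity f) (\<lambda>x\<in>nlists (arity f) A. fn f (r x)) \<in> admissible"
      if "bij_betw r (nlists (arity f) A) (nlists (arity f) A)" "P r" for r
    proof (rule admissibleI[where q = "fn f \<circ> r"])
      show "P (fn f \<circ> r)" if "arity f = n"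
        using admissibleD(3)[OF f] \<open>bij_betw r _ _\<close> admissibleD(4)[OF f that] \<open>P r\<close>
        unfolding that by (rule comp)
      show "bij_betw (fn f \<circ> r) (nlists (arity f) A) (nlists (arity f) A)"
        using that(1) admissibleD(3)[OF f] by (rule bij_betw_trans)
    qed (simp_all add: admissibleD(1)[OF f, simplified])
    have "bij_betw rotate1 (nlists (arity f) A) (nlists (arity f) A)"
      using bij_betw_rotate[of 1 "arity f" A] by (simp add: rotate_def)
    from precompose[OF this rotate1] show "zeta A f \<in> admissible"
      unfolding zeta_def admissibleD(2)[OF f] .
    from precompose[OF bij_betw_swap2 swap2] show "tau A f \<in> admissible"
      unfolding tau_def admissibleD(2)[OF f] .
  qed
  ultimately show ?thesis
    unfolding toffoli_algebra_def
    by (intro conjI ballI allI impI oplus_admissible kcomp_admissible) simp_all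
qed

lemma closure_invariant:
  assumes "F \<subseteq> (\<Union>i\<in>{1..<n}. bijections A i)"
    and "f \<in> toffoli_closure A F" and "arity f = n"
  shows "P (fn f)"
proof -
  have "F \<subseteq> admissible"
  proof
    fix g assume "g \<in> F"
    from subsetD[OF assms(1) this]
    obtain i where "1 \<le> i" "i < n" and i: "g \<in> bijections A i" by auto
    moreover have "arity g = i" using i by (simp add: bijections_def vmaps_def)
    ultimately show "g \<in> admissible" by (simp add: admissible_def)
  qed
  then have "toffoli_closure A F \<subseteq> admissible"
    by (rule toffoli_closure_least[OF toffoli_algebra_admissible])
  then have "f \<in> admissible" using assms(2) by (rule subsetD)
  then show ?thesis using assms(3) by (rule admissibleD(4))
qed

end

section \<open>The sign invariant\<close>

lemma sign_on_Un_disjoint: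
  assumes "finite S" "finite T" "S \<inter> T = {}" "bij_betw q S S" "bij_betw q T T"
  shows "sign_on (S \<union> T) q = sign_on S q * sign_on T q"
proof -
  have S: "permutation (restrict_id q S)" and T: "permutation (restrict_id q T)"
    by (rule permutes_imp_permutation[OF _ permutes_restrict_id]; fact)+
  have "restrict_id q (S \<union> T) = restrict_id q S \<circ> restrict_id q T"
  proof
    fix x
    show "restrict_id q (S \<union> T) x = (restrict_id q S \<circ> restrict_id q T) x"
    proof (cases "x \<in> T")
      case True
      then have "q x \<in> T" using bij_betwE[OF assms(5)] by blast
      then have "q x \<notin> S" using assms(3) by blast
      then show ?thesis using True by simp
    next
      case False
      then show ?thesis by (cases "x \<in> S") simp_all
    qed
  qed
  then show ?thesis
    unfolding sign_on_def using sign_compose[OF S T] by (simp only:)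
qed

lemma sign_on_image:
  assumes "finite X" and inj: "inj_on e X" and p: "bij_betw p X X"
    and q: "\<And>x. x \<in> X \<Longrightarrow> q (e x) = e (p x)"
  shows "sign_on (e ` X) q = sign_on X p"
proof -
  have "restrict_id q (e ` X) = map_permutation X e (restrict_id p X)"
  proof
    fix y
    show "restrict_id q (e ` X) y = map_permutation X e (restrict_id p X) y"
    proof (cases "y \<in> e ` X")
      case True
      then obtain x where "x \<in> X" "y = e x" by blast
      then show ?thesis using q map_permutation_apply[OF inj, of x "restrict_id p X"] by simp
    next
      case False
      then show ?thesis by (simp add: map_permutation_def)
    qed
  qed
  then show ?thesis
    unfolding sign_on_def
    using sign_map_permutation[OF inj permutes_restrict_id[OF p] assms(1)] by (simp only:)
qed

text \<open>
  A bijection acting as a copy of \<open>p\<close> on each of the disjoint blocks \<open>e ` (X \<times> {y})\<close> is the product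
  of its restrictions to the blocks, each of which has the sign of \<open>p\<close>. The bijectivity claim is
  carried along because the multiplicativity of the sign needs it in the induction.
\<close>
lemma sign_on_parallel:
  assumes "finite Y" and X: "finite X" and "inj_on e (X \<times> Y)" and p: "bij_betw p X X"
    and "\<And>x y. x \<in> X \<Longrightarrow> y \<in> Y \<Longrightarrow> q (e (x, y)) = e (p x, y)"
  shows "bij_betw q (e ` (X \<times> Y)) (e ` (X \<times> Y)) \<and> sign_on (e ` (X \<times> Y)) q = sign_on X p ^ card Y"
  using assms(1,3,5)
proof (induction Y rule: finite_induct)
  case empty
  then show ?case by (simp add: bij_betw_def sign_on_def restrict_id_def)
next
  case (insert y Y)
  define S T where "S = (\<lambda>x. e (x, y)) ` X" and "T = e ` (X \<times> Y)"
  have split: "e ` (X \<times> insert y Y) = S \<union> T" by (auto simp: S_def T_def)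
  have inj: "inj_on (\<lambda>x. e (x, y)) X" using insert.prems(1) by (auto simp: inj_on_def)
  have disj: "S \<inter> T = {}"
    using insert.hyps(2) insert.prems(1) by (auto simp: S_def T_def inj_on_def)
  have T: "bij_betw q T T" "sign_on T q = sign_on X p ^ card Y"
    unfolding T_def using insert.IH insert.prems by (auto simp: inj_on_def)
  have pX: "p ` X = X" using p by (simp add: bij_betw_def)
  have S: "sign_on S q = sign_on X p"
    unfolding S_def using X inj p insert.prems(2) by (intro sign_on_image) auto
  have "q ` S = S"
  proof -
    have "q ` S = (\<lambda>x. e (p x, y)) ` X"
      unfolding S_def image_image using insert.prems(2) by (intro image_cong) auto
    also have "\<dots> = (\<lambda>x. e (x, y)) ` p ` X" by (simp add: image_image)
    finally show ?thesis by (simp add: pX S_def)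
  qed
  then have bijS: "bij_betw q S S"
    using X by (simp add: bij_betw_def S_def eq_card_imp_inj_on)
  have "sign_on (S \<union> T) q = sign_on S q * sign_on T q"
    using X insert.hyps(1) disj bijS T(1) by (intro sign_on_Un_disjoint) (auto simp: S_def T_def)
  moreover have "bij_betw q (S \<union> T) (S \<union> T)"
    using bijS T(1) disj by (rule bij_betw_combine)
  ultimately show ?case using S T(2) insert.hyps by (simp add: split)
qed

lemma sign_on_power_even: "even m \<Longrightarrow> sign_on X p ^ m = 1"
  by (auto simp: sign_on_def sign_def)

lemma nlists_split:
  assumes "k \<le> n"
  shows "nlists n A = (\<lambda>(x, y). x @ y) ` (nlists k A \<times> nlists (n - k) A)"
proof (intro equalityI subsetI)
  fix x assume x: "x \<in> nlists n A"
  have "x = (\<lambda>(x, y). x @ y) (take k x, drop k x)" by simp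
  then show "x \<in> (\<lambda>(x, y). x @ y) ` (nlists k A \<times> nlists (n - k) A)"
    using take_in_nlists[OF x assms] drop_in_nlists[OF x, of k] by blast
next
  fix x assume "x \<in> (\<lambda>(x, y). x @ y) ` (nlists k A \<times> nlists (n - k) A)"
  then show "x \<in> nlists n A"
    using nlists_appendI[of _ k A _ "n - k"] assms by auto
qed

text \<open>
  The blocks are indexed by the values of the coordinates left alone. As there is at least one
  such coordinate, their number is a positive power of \<open>card A\<close> and thus even.
\<close>
lemma sign_on_on_prefix:
  assumes "finite A" "even (card A)" "k < n" and p: "bij_betw p (nlists k A) (nlists k A)"
  shows "sign_on (nlists n A) (on_prefix k p) = 1"
proof -
  let ?e = "\<lambda>(x, y). x @ y"
  have "inj_on ?e (nlists k A \<times> nlists (n - k) A)"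
    by (auto simp: inj_on_def nlists_def)
  moreover have "on_prefix k p (?e (x, y)) = ?e (p x, y)" if "x \<in> nlists k A" for x y
    using nlistsE_length[OF that] by (simp add: on_prefix_def)
  ultimately have "sign_on (nlists n A) (on_prefix k p)
      = sign_on (nlists k A) p ^ card (nlists (n - k) A)"
    using assms(3) sign_on_parallel[of "nlists (n - k) A" "nlists k A" ?e p "on_prefix k p"]
      finite_nlists[OF assms(1)] p
    by (simp add: nlists_split[of k n])
  then show ?thesis
    using assms by (simp add: card_nlists sign_on_power_even)
qed

lemma sign_on_on_suffix:
  assumes "finite A" "even (card A)" "1 \<le> k" "k \<le> n"
    and p: "bij_betw p (nlists (n - k) A) (nlists (n - k) A)"
  shows "sign_on (nlists n A) (on_suffix k p) = 1"
proof -
  let ?e = "\<lambda>(y, x). x @ y"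
  have "inj_on ?e (nlists (n - k) A \<times> nlists k A)"
    by (auto simp: inj_on_def nlists_def)
  moreover have "on_suffix k p (?e (y, x)) = ?e (p y, x)" if "x \<in> nlists k A" for x y
    using nlistsE_length[OF that] by (simp add: on_suffix_def)
  moreover have "nlists n A = ?e ` (nlists (n - k) A \<times> nlists k A)"
    unfolding nlists_split[OF assms(4)] by force
  ultimately have "sign_on (nlists n A) (on_suffix k p)
      = sign_on (nlists (n - k) A) p ^ card (nlists k A)"
    using sign_on_parallel[of "nlists k A" "nlists (n - k) A" ?e p "on_suffix k p"]
      finite_nlists[OF assms(1)] p
    by simp
  then show ?thesis
    using assms by (simp add: card_nlists sign_on_power_even)
qed

lemma sign_on_swap2:
  assumes "finite A" "even (card A)" "n \<noteq> 2"
  shows "sign_on (nlists n A) swap2 = 1"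
proof (cases "n < 2")
  case True
  have "sign_on (nlists n A) swap2 = sign_on (nlists n A) id"
  proof (rule sign_on_cong[OF refl])
    fix x assume "x \<in> nlists n A"
    then have "length x = n" by (rule nlistsE_length)
    then show "swap2 x = id x" using True by (cases x rule: swap2.cases) auto
  qed
  then show ?thesis by simp
next
  case False
  have "sign_on (nlists n A) swap2 = sign_on (nlists n A) (on_prefix 2 swap2)"
  proof (rule sign_on_cong[OF refl])
    fix x assume "x \<in> nlists n A"
    then have "length x = n" by (rule nlistsE_length)
    then show "swap2 x = on_prefix 2 swap2 x"
      using False by (cases x rule: swap2.cases) (auto simp: on_prefix_def)
  qed
  also have "\<dots> = 1"
    using assms False by (intro sign_on_on_prefix bij_betw_swap2) auto
  finally show ?thesis .
qed

lemma gate_invariant_sign: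
  assumes "finite A" "even (card A)" "n \<noteq> 2"
  shows "gate_invariant A n (\<lambda>p. sign_on (nlists n A) p = 1)"
proof
  fix p q :: "'a list \<Rightarrow> 'a list" and k :: nat
  show "sign_on (nlists n A) q = 1"
    if "sign_on (nlists n A) p = 1" "\<And>x. x \<in> nlists n A \<Longrightarrow> p x = q x"
  proof -
    have "sign_on (nlists n A) p = sign_on (nlists n A) q"
      using that(2) by (intro sign_on_cong refl)
    then show ?thesis using that(1) by (rule trans[OF sym])
  qed
  show "sign_on (nlists n A) (p \<circ> q) = 1"
    if "bij_betw p (nlists n A) (nlists n A)" "bij_betw q (nlists n A) (nlists n A)"
      "sign_on (nlists n A) p = 1" "sign_on (nlists n A) q = 1"
    using sign_on_compose[OF that(1,2) finite_nlists[OF assms(1)]] that(3,4)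
    by simp
  show "sign_on (nlists n A) (on_prefix k p) = 1"
    if "1 \<le> k" "k < n" "bij_betw p (nlists k A) (nlists k A)"
    using assms(1,2) that(2,3) by (rule sign_on_on_prefix)
  show "sign_on (nlists n A) (on_suffix k p) = 1"
    if "1 \<le> k" "k < n" "bij_betw p (nlists (n - k) A) (nlists (n - k) A)"
    using assms(1,2) that(1) less_imp_le[OF that(2)] that(3) by (rule sign_on_on_suffix)
  show "sign_on (nlists n A) swap2 = 1"
    using assms by (rule sign_on_swap2)
qed

section \<open>The invariant for two coordinates\<close>

text \<open>
  These are the maps \<open>\<alpha> \<times> \<beta>\<close>, possibly preceded by the exchange of the inputs. Allowing the exchange
  is what makes the property hold for \<open>swap2\<close> while composition still preserves it.
\<close>
definition separable :: "'a set \<Rightarrow> ('a list \<Rightarrow> 'a list) \<Rightarrow> bool" where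
  "separable A p \<longleftrightarrow> (\<exists>\<alpha> \<beta>.
     (\<forall>a\<in>A. \<forall>b\<in>A. p [a, b] = [\<alpha> a, \<beta> b]) \<or> (\<forall>a\<in>A. \<forall>b\<in>A. p [a, b] = [\<alpha> b, \<beta> a]))"

lemma gate_invariant_separable: "gate_invariant A 2 (separable A)"
proof
  have pair: "[a, b] \<in> nlists 2 A" if "a \<in> A" "b \<in> A" for a b
    using that by (simp add: nlists_def)
  fix p q :: "'a list \<Rightarrow> 'a list" and k :: nat
  show "separable A q" if "separable A p" "\<And>x. x \<in> nlists 2 A \<Longrightarrow> p x = q x"
    using that(1) unfolding separable_def by (simp add: that(2) pair)
  show "separable A (p \<circ> q)"
    if "bij_betw p (nlists 2 A) (nlists 2 A)" and q: "bij_betw q (nlists 2 A) (nlists 2 A)"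
      and sep: "separable A p" "separable A q"
  proof -
    obtain \<alpha> \<beta> where p: "(\<forall>a\<in>A. \<forall>b\<in>A. p [a, b] = [\<alpha> a, \<beta> b]) \<or> (\<forall>a\<in>A. \<forall>b\<in>A. p [a, b] = [\<alpha> b, \<beta> a])"
      using sep(1) unfolding separable_def by blast
    obtain \<gamma> \<delta> where q2: "(\<forall>a\<in>A. \<forall>b\<in>A. q [a, b] = [\<gamma> a, \<delta> b]) \<or> (\<forall>a\<in>A. \<forall>b\<in>A. q [a, b] = [\<gamma> b, \<delta> a])"
      using sep(2) unfolding separable_def by blast
    have mem: "\<gamma> a \<in> A \<and> \<delta> a \<in> A" if "a \<in> A" for a
    proof -
      have "q [a, a] \<in> nlists 2 A" by (rule bspec[OF bij_betwE[OF q] pair[OF that that]])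
      moreover have "q [a, a] = [\<gamma> a, \<delta> a]" using q2 that by (elim disjE) simp_all
      ultimately show ?thesis using nlistsE_set[of "q [a, a]" 2 A] by simp
    qed
    from p show ?thesis
    proof
      assume p': "\<forall>a\<in>A. \<forall>b\<in>A. p [a, b] = [\<alpha> a, \<beta> b]"
      from q2 show ?thesis
      proof
        assume "\<forall>a\<in>A. \<forall>b\<in>A. q [a, b] = [\<gamma> a, \<delta> b]"
        then have "\<forall>a\<in>A. \<forall>b\<in>A. (p \<circ> q) [a, b] = [\<alpha> (\<gamma> a), \<beta> (\<delta> b)]"
          using p' mem by simp
        then show ?thesis unfolding separable_def
          by (intro exI[of _ "\<lambda>a. \<alpha> (\<gamma> a)"] exI[of _ "\<lambda>b. \<beta> (\<delta> b)"] disjI1)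
      next
        assume "\<forall>a\<in>A. \<forall>b\<in>A. q [a, b] = [\<gamma> b, \<delta> a]"
        then have "\<forall>a\<in>A. \<forall>b\<in>A. (p \<circ> q) [a, b] = [\<alpha> (\<gamma> b), \<beta> (\<delta> a)]"
          using p' mem by simp
        then show ?thesis unfolding separable_def
          by (intro exI[of _ "\<lambda>b. \<alpha> (\<gamma> b)"] exI[of _ "\<lambda>a. \<beta> (\<delta> a)"] disjI2)
      qed
    next
      assume p': "\<forall>a\<in>A. \<forall>b\<in>A. p [a, b] = [\<alpha> b, \<beta> a]"
      from q2 show ?thesis
      proof
        assume "\<forall>a\<in>A. \<forall>b\<in>A. q [a, b] = [\<gamma> a, \<delta> b]"
        then have "\<forall>a\<in>A. \<forall>b\<in>A. (p \<circ> q) [a, b] = [\<alpha> (\<delta> b), \<beta> (\<gamma> a)]"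
          using p' mem by simp
        then show ?thesis unfolding separable_def
          by (intro exI[of _ "\<lambda>b. \<alpha> (\<delta> b)"] exI[of _ "\<lambda>a. \<beta> (\<gamma> a)"] disjI2)
      next
        assume "\<forall>a\<in>A. \<forall>b\<in>A. q [a, b] = [\<gamma> b, \<delta> a]"
        then have "\<forall>a\<in>A. \<forall>b\<in>A. (p \<circ> q) [a, b] = [\<alpha> (\<delta> a), \<beta> (\<gamma> b)]"
          using p' mem by simp
        then show ?thesis unfolding separable_def
          by (intro exI[of _ "\<lambda>a. \<alpha> (\<delta> a)"] exI[of _ "\<lambda>b. \<beta> (\<gamma> b)"] disjI1)
      qed
    qed
  qed
  have single: "p [a] = [hd (p [a])]" if "bij_betw p (nlists 1 A) (nlists 1 A)" "a \<in> A" for a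
  proof -
    have "[a] \<in> nlists 1 A" using that(2) by (simp add: nlists_def)
    then have "p [a] \<in> nlists 1 A" by (rule bspec[OF bij_betwE[OF that(1)]])
    then have "length (p [a]) = 1" by (rule nlistsE_length)
    then show ?thesis by (cases "p [a]") simp_all
  qed
  show "separable A (on_prefix k p)"
    if "1 \<le> k" "k < 2" "bij_betw p (nlists k A) (nlists k A)"
  proof -
    have "k = 1" using that by simp
    then have "\<forall>a\<in>A. \<forall>b\<in>A. on_prefix k p [a, b] = [hd (p [a]), b]"
      using single that(3) by (simp add: on_prefix_def)
    then show ?thesis unfolding separable_def
      by (intro exI[of _ "\<lambda>a. hd (p [a])"] exI[of _ "\<lambda>b. b"]) simp
  qed
  show "separable A (on_suffix k p)"
    if "1 \<le> k" "k < 2" "bij_betw p (nlists (2 - k) A) (nlists (2 - k) A)"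
  proof -
    have "k = 1" using that by simp
    then have "\<forall>a\<in>A. \<forall>b\<in>A. on_suffix k p [a, b] = [a, hd (p [b])]"
      using single that(3) by (simp add: on_suffix_def)
    then show ?thesis unfolding separable_def
      by (intro exI[of _ "\<lambda>a. a"] exI[of _ "\<lambda>b. hd (p [b])"]) simp
  qed
  show "separable A swap2"
    unfolding separable_def by (intro exI[of _ "\<lambda>b. b"]) simp
qed

section \<open>The controlled transposition violates the invariants\<close>

text \<open>
  The gate changes a tuple only if its first \<open>n - 1\<close> entries are \<open>c\<close>, and then exchanges the last
  entries \<open>c\<close> and \<open>a\<close>: it is the transposition of two points of \<open>A\<^sup>n\<close>.
\<close>
lemma sign_on_toffoli_gate_transpose:
  assumes "finite A" "1 \<le> n" "c \<in> A" "a \<in> A" "a \<noteq> c"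
  shows "sign_on (nlists n A) (fn (toffoli_gate A n (transpose c a) c)) = -1"
proof -
  let ?w = "\<lambda>b. replicate (n - 1) c @ [b]"
  have w: "?w b \<in> nlists n A" if "b \<in> A" for b
    using assms that by (auto simp: nlists_def)
  have "sign_on (nlists n A) (fn (toffoli_gate A n (transpose c a) c))
      = sign_on (nlists n A) (transpose (?w c) (?w a))"
  proof (rule sign_on_cong[OF refl])
    fix x assume x: "x \<in> nlists n A"
    then have "length x = n" by (rule nlistsE_length)
    then have "x \<noteq> []" using assms(2) by auto
    have *: "(\<forall>y\<in>set (butlast x). y = c) \<longleftrightarrow> x = ?w (last x)"
    proof
      assume "\<forall>y\<in>set (butlast x). y = c"
      then have "butlast x = replicate (n - 1) c"
        using \<open>length x = n\<close> by (intro replicate_eqI) auto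
      then show "x = ?w (last x)" using append_butlast_last_id[OF \<open>x \<noteq> []\<close>] by simp
    next
      assume "x = ?w (last x)"
      then have "butlast x = replicate (n - 1) c" by (metis butlast_snoc)
      then show "\<forall>y\<in>set (butlast x). y = c" by simp
    qed
    show "fn (toffoli_gate A n (transpose c a) c) x = transpose (?w c) (?w a) x"
    proof (cases "x = ?w (last x)")
      case True
      then have "butlast x = replicate (n - 1) c" by (metis butlast_snoc)
      then have "fn (toffoli_gate A n (transpose c a) c) x = ?w (transpose c a (last x))"
        using x * True by (simp add: toffoli_gate_def)
      also have "\<dots> = transpose (?w c) (?w a) (?w (last x))"
        by (simp add: transpose_def)
      finally show ?thesis using True by simp
    next
      case False
      then have "x \<noteq> ?w c" "x \<noteq> ?w a" by auto
      then have "transpose (?w c) (?w a) x = x" by (rule transpose_apply_other)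
      moreover have "\<not> (\<forall>y\<in>set (butlast x). y = c)" using False * by blast
      ultimately show ?thesis using x by (auto simp: toffoli_gate_def)
    qed
  qed
  also have "\<dots> = -1"
    using assms w finite_nlists[OF assms(1)] by (intro sign_on_transpose) auto
  finally show ?thesis .
qed

text \<open>
  The values at \<open>(c, c)\<close>, \<open>(a, c)\<close> and \<open>(c, a)\<close> show that the second output changes with either input.
\<close>
lemma not_separable_toffoli_gate_transpose:
  assumes "c \<in> A" "a \<in> A" "a \<noteq> c"
  shows "\<not> separable A (fn (toffoli_gate A 2 (transpose c a) c))"
proof
  let ?g = "fn (toffoli_gate A 2 (transpose c a) c)"
  assume "separable A ?g"
  then obtain \<alpha> \<beta> where
    "(\<forall>a\<in>A. \<forall>b\<in>A. ?g [a, b] = [\<alpha> a, \<beta> b]) \<or> (\<forall>a\<in>A. \<forall>b\<in>A. ?g [a, b] = [\<alpha> b, \<beta> a])"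
    unfolding separable_def by blast
  moreover have "?g [c, c] = [c, a]" "?g [a, c] = [a, c]" "?g [c, a] = [c, c]"
    using assms by (auto simp: toffoli_gate_def nlists_def)
  ultimately show False using assms by fastforce
qed

theorem corollary5p9:
  fixes A :: "'a set" and n :: nat and c :: 'a
  assumes "finite A" and "A \<noteq> {}" and "even (card A)" and "n \<ge> 1" and "c \<in> A"
  shows "\<not> bijections A n \<subseteq>
    toffoli_closure A {toffoli_gate A i \<alpha> c | i \<alpha>. \<alpha> permutes A \<and> 1 \<le> i \<and> i < n}"
proof
  let ?F = "{toffoli_gate A i \<alpha> c | i \<alpha>. \<alpha> permutes A \<and> 1 \<le> i \<and> i < n}"
  assume all: "bijections A n \<subseteq> toffoli_closure A ?F"
  \<comment> \<open>Evenness excludes a singleton, so there is a second element to transpose \<open>c\<close> with.\<close>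
  have "card A \<noteq> 1" using assms(3) by auto
  then have "A \<noteq> {c}" by auto
  then obtain a where a: "a \<in> A" "a \<noteq> c" using assms(2) by blast
  let ?g = "toffoli_gate A n (transpose c a) c"
  have "?g \<in> bijections A n"
    using a assms(4,5) by (intro toffoli_gate_in_bijections permutes_swap_id) auto
  then have g: "?g \<in> toffoli_closure A ?F" using all by blast
  have F: "?F \<subseteq> (\<Union>i\<in>{1..<n}. bijections A i)"
  proof
    fix f assume "f \<in> ?F"
    then obtain i \<alpha> where i: "1 \<le> i" "i < n" and "\<alpha> permutes A" "f = toffoli_gate A i \<alpha> c"
      by blast
    then have "f \<in> bijections A i" using toffoli_gate_in_bijections by simp
    moreover have "i \<in> {1..<n}" using i by simp
    ultimately show "f \<in> (\<Union>i\<in>{1..<n}. bijections A i)" by (rule UN_I[rotated])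
  qed
  have n: "arity ?g = n" by (simp add: toffoli_gate_def)
  show False
  proof (cases "n = 2")
    case True
    have "separable A (fn ?g)"
      using F g n unfolding True
      by (rule gate_invariant.closure_invariant[OF gate_invariant_separable])
    then show False using not_separable_toffoli_gate_transpose[OF assms(5) a] True by simp
  next
    case False
    have "sign_on (nlists n A) (fn ?g) = 1"
      using gate_invariant.closure_invariant[OF gate_invariant_sign[OF assms(1,3) False] F g n] .
    then show False
      using sign_on_toffoli_gate_transpose[OF assms(1,4,5) a] by simp
  qed
qed

end
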